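(* Let $\mathcal{C}=(F_v,F_e,\mathbb{Z}^d)$ be a crystal framework in $\mathbb{R}^d$ with Maxwell counting equilibrium, i.e. $d|F_v|=|F_e|$. The following are equivalent. (i) $\mathcal{C}$ has a nonzero internal (finitely supported) infinitesimal flex. (ii) $\mathcal{C}$ has a nonzero summable infinitesimal flex. (iii) $\mathcal{C}$ has a nonzero square-summable infinitesimal flex.
   Context: A crystal framework $\mathcal{C}=(F_v,F_e,\mathbb{Z}^d)$ in $\mathbb{R}^d$ is a connected countable bar-joint framework $(G,p)$, $G=(V,E)$ simple, edges of nonzero length, together with a discrete group of translations $T_n$ ($n\in\mathbb{Z}^d$, $T_nx=x+n_1a_1+\cdots+n_da_d$ with $a_1,\dots,a_d$ linearly independent), a finite connected set $F_e$ of framework edges and a finite set $F_v$ of framework vertices (contained in the vertex set of $F_e$) such that the translates of $F_e$ (resp. $F_v$) under the $T_n$ are disjoint with union all framework edges (resp. vertices). An infinitesimal flex is a family $u=(u_v)_{v\in V}$ of vectors in $\mathbb{C}^d$ (or $\mathbb{R}^d$) with $(p_v-p_w)\cdot(u_v-u_w)=0$ for every edge $vw$. It is internal if $u_v=0$ for all but finitely many $v$, summable if $\sum_v|u_v|<\infty$, and square-summable if $\sum_v|u_v|^2<\infty$. *)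

theory Defs
  imports "HOL-Analysis.Analysis"
begin

definition graph_connected :: "'v set \<Rightarrow> 'v set set \<Rightarrow> bool" where
  "graph_connected V E \<longleftrightarrow> (\<forall>v\<in>V. \<forall>w\<in>V. (v, w) \<in> {(x, y). {x, y} \<in> E}\<^sup>*)"

locale bar_joint_framework =
  fixes V :: "'v set" and E :: "'v set set" and p :: "'v \<Rightarrow> real ^ 'd"
  assumes countable_vertices: "countable V"
    and simple: "e \<in> E \<Longrightarrow> \<exists>v\<in>V. \<exists>w\<in>V. v \<noteq> w \<and> e = {v, w}"
    and nonzero_length: "{v, w} \<in> E \<Longrightarrow> p v \<noteq> p w"

definition lattice_vector :: "('d \<Rightarrow> real ^ 'd) \<Rightarrow> int ^ 'd \<Rightarrow> real ^ 'd" where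
  "lattice_vector a n = (\<Sum>i\<in>UNIV. of_int (n $ i) *\<^sub>R a i)"

text \<open>
  The placement \<open>p\<close> is not assumed injective, so a translation of space alone does not say
  which vertex a given vertex is moved to. The translation group is therefore given together with
  its action \<open>T\<close> on vertices, which covers the translations via \<open>p\<close>; for injective \<open>p\<close>
  the action is determined on \<open>V\<close> by the axiom \<open>placement_translate\<close>. Edges are translated
  by \<open>image (T n)\<close>.
\<close>

locale crystal_framework = bar_joint_framework V E p
  for V :: "'v set" and E :: "'v set set" and p :: "'v \<Rightarrow> real ^ 'd" +
  fixes a :: "'d \<Rightarrow> real ^ 'd"
    and T :: "int ^ 'd \<Rightarrow> 'v \<Rightarrow> 'v"
    and Fv :: "'v set" and Fe :: "'v set set"
  assumes connected: "graph_connected V E"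
    and inj_periods: "inj a"
    and independent_periods: "independent (range a)"
    and translate_vertex: "v \<in> V \<Longrightarrow> T n v \<in> V"
    and translate_edge: "e \<in> E \<Longrightarrow> T n ` e \<in> E"
    and translate_zero: "v \<in> V \<Longrightarrow> T 0 v = v"
    and translate_add: "v \<in> V \<Longrightarrow> T (m + n) v = T m (T n v)"
    and placement_translate: "v \<in> V \<Longrightarrow> p (T n v) = p v + lattice_vector a n"
    and finite_Fv: "finite Fv"
    and finite_Fe: "finite Fe"
    and Fv_subset: "Fv \<subseteq> V"
    and Fe_subset: "Fe \<subseteq> E"
    and Fv_subset_Fe: "Fv \<subseteq> \<Union>Fe"
    and connected_Fe: "graph_connected (\<Union>Fe) Fe"
    and disjoint_vertex_translates: "disjoint_family (\<lambda>n. T n ` Fv)"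
    and Union_vertex_translates: "(\<Union>n. T n ` Fv) = V"
    and disjoint_edge_translates: "disjoint_family (\<lambda>n. image (T n) ` Fe)"
    and Union_edge_translates: "(\<Union>n. image (T n) ` Fe) = E"

text \<open>
  Flexes take values in \<open>'k ^ 'd\<close>, where \<open>'k\<close> is \<open>real\<close> or \<open>complex\<close>. The product is the
  bilinear (not sesquilinear) dot product. Only the values on \<open>V\<close> matter.
\<close>

definition infinitesimal_flex ::
    "'v set set \<Rightarrow> ('v \<Rightarrow> real ^ 'd) \<Rightarrow> ('v \<Rightarrow> 'k :: real_normed_field ^ 'd) \<Rightarrow> bool" where
  "infinitesimal_flex E p u \<longleftrightarrow>
     (\<forall>v w. {v, w} \<in> E \<longrightarrow> (\<Sum>i\<in>UNIV. of_real ((p v - p w) $ i) * (u v - u w) $ i) = 0)"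

definition nonzero_flex :: "'v set \<Rightarrow> ('v \<Rightarrow> 'k :: real_normed_field ^ 'd) \<Rightarrow> bool" where
  "nonzero_flex V u \<longleftrightarrow> (\<exists>v\<in>V. u v \<noteq> 0)"

definition internal_flex :: "'v set \<Rightarrow> ('v \<Rightarrow> 'k :: real_normed_field ^ 'd) \<Rightarrow> bool" where
  "internal_flex V u \<longleftrightarrow> finite {v \<in> V. u v \<noteq> 0}"

definition summable_flex :: "'v set \<Rightarrow> ('v \<Rightarrow> 'k :: real_normed_field ^ 'd) \<Rightarrow> bool" where
  "summable_flex V u \<longleftrightarrow> (\<lambda>v. norm (u v)) summable_on V"

definition square_summable_flex :: "'v set \<Rightarrow> ('v \<Rightarrow> 'k :: real_normed_field ^ 'd) \<Rightarrow> bool" where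
  "square_summable_flex V u \<longleftrightarrow> (\<lambda>v. (norm (u v))\<^sup>2) summable_on V"

end

theory Submission
  imports Defs
begin

text \<open>
  A finitely supported flex is summable and a summable flex is square-summable, so everything rests
  on producing a finitely supported flex from a nonzero square-summable flex \<open>u\<close>. Real and imaginary
  parts of a complex flex are real flexes, because the placement is real, so \<open>u\<close> may be taken real.

  The argument is a dimension count of the kind used for amenable groups. Take a box of \<open>N^d\<close>
  lattice cells, and consider the linear combinations of the translates of \<open>u\<close> by the lattice
  points of the box. If such a combination vanishes at all
  vertices in the outer shell of the box, where the shell is at least as thick as the reach of every
  edge, then cutting it off outside the box leaves a flex (\<open>flex_truncate\<close>). Vanishing on the shell
  is only \<open>O(N^(d-1))\<close> linear conditions on the \<open>N^d\<close> coefficients (\<open>card_lattice_box_shell\<close>). What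
  has to be excluded is that they force the combination to vanish on the whole box.

  For this, record one component of the translates of \<open>u\<close> at one vertex orbit in a matrix \<open>M\<close>
  indexed by the lattice points of the box. Its diagonal entries all equal one nonzero value \<open>x\<close> of
  \<open>u\<close>, and the squares in each row sum to at most the squared \<open>l^2\<close>-norm \<open>A\<close> of \<open>u\<close>, since the
  entries of a row are values of \<open>u\<close> at distinct vertices. If \<open>k\<close> linear conditions annihilate
  \<open>M\<close>, then \<open>M\<close> has rank at most \<open>k\<close>, and the inequality
  \<open>(tr M)^2 \<le> rank M * \<parallel>M\<parallel>^2\<close> for the Hilbert-Schmidt norm (\<open>trace_square_le_constraints\<close>)
  gives \<open>(N^d * x)^2 \<le> k * N^d * A\<close>, that is \<open>k \<ge> N^d * x^2 / A\<close>. This contradicts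
  \<open>k = O(N^(d-1))\<close> for large \<open>N\<close>.
\<close>

section \<open>Trace and rank of a finite matrix\<close>

text \<open>
  The index set of the matrix is a box whose size is chosen during the proof, so vectors are functions
  on a finite set \<open>B\<close> instead of elements of a Euclidean space type.
\<close>

definition dot_on :: "'b set \<Rightarrow> ('b \<Rightarrow> real) \<Rightarrow> ('b \<Rightarrow> real) \<Rightarrow> real" where
  "dot_on B f g = (\<Sum>b\<in>B. f b * g b)"

definition orthonormal_on :: "'b set \<Rightarrow> ('b \<Rightarrow> real) set \<Rightarrow> bool" where
  "orthonormal_on B G \<longleftrightarrow> finite G \<and> (\<forall>g\<in>G. \<forall>h\<in>G. dot_on B g h = (if g = h then 1 else 0))"

text \<open>For orthonormal \<open>G\<close>, this is the orthogonal projection of \<open>f\<close> to the complement of the span of \<open>G\<close>.\<close>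

definition residual_on :: "'b set \<Rightarrow> ('b \<Rightarrow> real) set \<Rightarrow> ('b \<Rightarrow> real) \<Rightarrow> 'b \<Rightarrow> real" where
  "residual_on B G f = (\<lambda>b. f b - (\<Sum>g\<in>G. dot_on B f g * g b))"

lemma dot_on_commute: "dot_on B f g = dot_on B g f"
  by (simp add: dot_on_def mult.commute)

lemma dot_on_scale_right: "dot_on B f (\<lambda>b. r * g b) = r * dot_on B f g"
  by (simp add: dot_on_def sum_distrib_left algebra_simps)

lemma dot_on_residual:
  "dot_on B c (residual_on B G f) = dot_on B c f - (\<Sum>g\<in>G. dot_on B f g * dot_on B c g)"
proof -
  have "(\<Sum>b\<in>B. c b * (\<Sum>g\<in>G. dot_on B f g * g b)) = (\<Sum>g\<in>G. dot_on B f g * dot_on B c g)"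
    unfolding dot_on_def[of B c] sum_distrib_left
    by (subst sum.swap) (simp add: mult.left_commute)
  then show ?thesis
    by (simp add: dot_on_def[of B c] residual_on_def right_diff_distrib sum_subtractf)
qed

lemma residual_on_orthogonal:
  assumes "orthonormal_on B G" "g \<in> G"
  shows "dot_on B (residual_on B G f) g = 0"
proof -
  have "(\<Sum>h\<in>G. dot_on B f h * dot_on B g h) = (\<Sum>h\<in>G. if g = h then dot_on B f h else 0)"
    using assms by (intro sum.cong) (auto simp: orthonormal_on_def)
  also have "\<dots> = dot_on B f g"
    using assms by (simp add: orthonormal_on_def)
  finally show ?thesis
    by (simp add: dot_on_commute[of B _ g] dot_on_residual)
qed

lemma dot_on_self_nonneg: "0 \<le> dot_on B f f"
  by (simp add: dot_on_def sum_nonneg)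

lemma dot_on_self_eq_0: "finite B \<Longrightarrow> dot_on B f f = 0 \<longleftrightarrow> (\<forall>b\<in>B. f b = 0)"
  by (simp add: dot_on_def sum_nonneg_eq_0_iff)

text \<open>Bessel's inequality: the difference of the two sides is the squared norm of the residual.\<close>

lemma bessel_on:
  assumes "orthonormal_on B G"
  shows "(\<Sum>g\<in>G. (dot_on B f g)\<^sup>2) \<le> dot_on B f f"
proof -
  let ?r = "residual_on B G f"
  have "dot_on B ?r ?r = dot_on B ?r f"
    using residual_on_orthogonal[OF assms] by (simp add: dot_on_residual[of B ?r])
  also have "\<dots> = dot_on B f f - (\<Sum>g\<in>G. (dot_on B f g)\<^sup>2)"
    by (simp add: dot_on_commute[of B ?r] dot_on_residual power2_eq_square)
  finally show ?thesis
    using dot_on_self_nonneg[of B ?r] by simp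
qed

text \<open>
  Gram-Schmidt orthonormalisation, phrased through annihilators: all that is used of the spans is
  that orthogonality to \<open>G\<close> implies orthogonality to \<open>H\<close>.
\<close>

lemma gram_schmidt_on:
  assumes "finite B" "finite H"
  shows "\<exists>G. orthonormal_on B G \<and> card G \<le> card H \<and>
    (\<forall>c. (\<forall>g\<in>G. dot_on B c g = 0) \<longrightarrow> (\<forall>h\<in>H. dot_on B c h = 0))"
  using assms(2)
proof (induction H)
  case empty
  then show ?case by (intro exI[of _ "{}"]) (simp add: orthonormal_on_def)
next
  case (insert h H)
  then obtain G where G: "orthonormal_on B G" "card G \<le> card H"
    "\<And>c h. \<forall>g\<in>G. dot_on B c g = 0 \<Longrightarrow> h \<in> H \<Longrightarrow> dot_on B c h = 0"
    by blast
  let ?r = "residual_on B G h"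
  have red: "dot_on B c h = dot_on B c ?r" if "\<forall>g\<in>G. dot_on B c g = 0" for c
    using that by (simp add: dot_on_residual)
  show ?case
  proof (cases "dot_on B ?r ?r = 0")
    case True
    then have "dot_on B c ?r = 0" for c
      using assms(1) dot_on_self_eq_0[of B ?r] by (simp add: dot_on_def[of B c])
    then have "\<forall>c. (\<forall>g\<in>G. dot_on B c g = 0) \<longrightarrow> (\<forall>h\<in>insert h H. dot_on B c h = 0)"
      using G(3) red by auto
    moreover have "card G \<le> card (insert h H)"
      using G(2) insert by simp
    ultimately show ?thesis
      using G(1) by blast
  next
    case False
    define s where "s = 1 / sqrt (dot_on B ?r ?r)"
    define e where "e = (\<lambda>b. s * ?r b)"
    have pos: "dot_on B ?r ?r > 0"
      using False dot_on_self_nonneg[of B ?r] by simp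
    have "dot_on B e e = s\<^sup>2 * dot_on B ?r ?r"
      by (simp add: e_def dot_on_scale_right dot_on_commute[of B "\<lambda>b. s * ?r b"] power2_eq_square)
    also have "\<dots> = 1"
      using pos by (simp add: s_def power_divide)
    finally have ee: "dot_on B e e = 1" .
    have eg: "dot_on B e g = 0" "dot_on B g e = 0" if "g \<in> G" for g
      using residual_on_orthogonal[OF G(1) that, of h]
      by (simp_all add: e_def dot_on_scale_right dot_on_commute[of B _ g])
    have "e \<notin> G"
      using ee eg by auto
    then have "orthonormal_on B (insert e G)"
      using G(1) ee eg by (auto simp: orthonormal_on_def)
    moreover have "card (insert e G) \<le> card (insert h H)"
      using G(1,2) insert \<open>e \<notin> G\<close> by (simp add: orthonormal_on_def)
    moreover have "dot_on B c h' = 0"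
      if c: "\<forall>g\<in>insert e G. dot_on B c g = 0" and h': "h' \<in> insert h H" for c h'
    proof -
      have "s * dot_on B c ?r = 0"
        using c dot_on_scale_right[of B c s ?r] by (simp add: e_def)
      then have "dot_on B c ?r = 0"
        using pos by (simp add: s_def)
      then show ?thesis
        using c h' G(3)[of c h'] red[of c] by auto
    qed
    ultimately show ?thesis
      by blast
  qed
qed

text \<open>
  The hypothesis puts the rows of \<open>M\<close> into the span of \<open>H\<close>, so \<open>card H\<close> bounds the rank of \<open>M\<close>.
  Expanding the rows in an orthonormal family \<open>G\<close>, the trace becomes the pairing of the matrix of
  coefficients with the matrix whose rows are the elements of \<open>G\<close>. By Bessel the former has square
  norm at most that of \<open>M\<close>, while the latter has square norm \<open>card G\<close>; Cauchy-Schwarz does the rest.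
\<close>

lemma trace_square_le_constraints:
  fixes M :: "'b \<Rightarrow> 'b \<Rightarrow> real"
  assumes "finite B" "finite H"
    and kernel: "\<And>c n. \<forall>h\<in>H. dot_on B c h = 0 \<Longrightarrow> n \<in> B \<Longrightarrow> dot_on B c (M n) = 0"
  shows "(\<Sum>n\<in>B. M n n)\<^sup>2 \<le> card H * (\<Sum>n\<in>B. \<Sum>m\<in>B. (M n m)\<^sup>2)"
proof -
  obtain G where G: "orthonormal_on B G" "card G \<le> card H"
    and GH: "\<And>c. \<forall>g\<in>G. dot_on B c g = 0 \<Longrightarrow> \<forall>h\<in>H. dot_on B c h = 0"
    using gram_schmidt_on[OF assms(1,2)] by blast
  have fin: "finite G"
    using G(1) by (simp add: orthonormal_on_def)
  \<comment> \<open>The residual of a row is orthogonal to \<open>G\<close>, hence to the row, hence to itself.\<close>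
  have expand: "M n b = (\<Sum>g\<in>G. dot_on B (M n) g * g b)" if "n \<in> B" "b \<in> B" for n b
  proof -
    let ?r = "residual_on B G (M n)"
    have orth: "\<forall>g\<in>G. dot_on B ?r g = 0"
      using residual_on_orthogonal[OF G(1)] by blast
    have "dot_on B ?r ?r = 0"
      using orth kernel[OF GH[OF orth] \<open>n \<in> B\<close>] by (simp add: dot_on_residual[of B ?r])
    then show ?thesis
      using assms(1) \<open>b \<in> B\<close> by (simp add: dot_on_self_eq_0 residual_on_def)
  qed
  have "(\<Sum>n\<in>B. M n n) = (\<Sum>n\<in>B. \<Sum>g\<in>G. dot_on B (M n) g * g n)"
    using expand by (intro sum.cong) auto
  also have "\<dots> = (\<Sum>(n, g)\<in>B \<times> G. dot_on B (M n) g * g n)"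
    by (simp add: sum.cartesian_product)
  finally have "(\<Sum>n\<in>B. M n n)\<^sup>2 = (\<Sum>x\<in>B \<times> G. dot_on B (M (fst x)) (snd x) * snd x (fst x))\<^sup>2"
    by (simp add: case_prod_beta)
  also have "\<dots> \<le> (\<Sum>x\<in>B \<times> G. (dot_on B (M (fst x)) (snd x))\<^sup>2) * (\<Sum>x\<in>B \<times> G. (snd x (fst x))\<^sup>2)"
    by (rule Cauchy_Schwarz_ineq_sum)
  also have "(\<Sum>x\<in>B \<times> G. (snd x (fst x))\<^sup>2) = (\<Sum>g\<in>G. dot_on B g g)"
    by (simp add: sum.cartesian_product' sum.swap[of _ G B] dot_on_def power2_eq_square)
  also have "\<dots> = card G"
    using G(1) by (simp add: orthonormal_on_def)
  also have "(\<Sum>x\<in>B \<times> G. (dot_on B (M (fst x)) (snd x))\<^sup>2) = (\<Sum>n\<in>B. \<Sum>g\<in>G. (dot_on B (M n) g)\<^sup>2)"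
    by (simp add: sum.cartesian_product')
  also have "(\<Sum>n\<in>B. \<Sum>g\<in>G. (dot_on B (M n) g)\<^sup>2) * card G \<le> (\<Sum>n\<in>B. dot_on B (M n) (M n)) * card H"
    using bessel_on[OF G(1)] G(2) by (intro mult_mono sum_mono) (auto intro!: sum_nonneg dot_on_self_nonneg)
  finally show ?thesis
    by (simp add: dot_on_def power2_eq_square mult.commute)
qed

section \<open>Boxes in the integer lattice\<close>

definition lattice_box :: "int \<Rightarrow> int \<Rightarrow> (int ^ 'd) set" where
  "lattice_box l h = {n. \<forall>i. n $ i \<in> {l..<h}}"

lemma lattice_box_eq_image: "lattice_box l h = vec_lambda ` (UNIV \<rightarrow>\<^sub>E {l..<h})"
proof -
  have "n \<in> vec_lambda ` (UNIV \<rightarrow>\<^sub>E {l..<h})" if "n \<in> lattice_box l h" for n :: "int ^ 'd"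
    using that by (intro image_eqI[of _ _ "vec_nth n"]) (auto simp: lattice_box_def)
  then show ?thesis
    by (auto simp: lattice_box_def)
qed

lemma finite_lattice_box: "finite (lattice_box l h)"
  by (simp add: lattice_box_eq_image finite_PiE)

lemma card_lattice_box: "card (lattice_box l h :: (int ^ 'd) set) = nat (h - l) ^ CARD('d)"
proof -
  have "inj_on vec_lambda (UNIV \<rightarrow>\<^sub>E {l..<h} :: ('d \<Rightarrow> int) set)"
    by (auto simp: inj_on_def vec_lambda_inject)
  then show ?thesis
    by (simp add: lattice_box_eq_image card_image card_PiE)
qed

text \<open>
  The shell is a vanishing proportion of the box as \<open>N\<close> grows with \<open>r\<close> fixed: Bernoulli's
  inequality gives \<open>1 - (1 - 2 * r / N)^d \<le> 2 * r * d / N\<close>.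
\<close>

lemma card_lattice_box_shell:
  fixes r N :: nat
  assumes "2 * r < N"
  shows "real (card (lattice_box 0 (int N) - lattice_box (int r) (int N - int r) :: (int ^ 'd) set))
    \<le> 2 * real r * real CARD('d) / real N * real (card (lattice_box 0 (int N) :: (int ^ 'd) set))"
proof -
  let ?d = "CARD('d)"
  have nat_eq: "nat (int N - int r - int r) = N - 2 * r"
    by simp
  have sub: "lattice_box (int r) (int N - int r) \<subseteq> (lattice_box 0 (int N) :: (int ^ 'd) set)"
    unfolding lattice_box_def by (intro Collect_mono impI allI) (smt (verit) atLeastLessThan_iff of_nat_0_le_iff)
  have "real (N - 2 * r) = real N * (1 + - (2 * real r / N))"
    using assms by (simp add: of_nat_diff field_simps)
  then have inner: "real ((N - 2 * r) ^ ?d) = real N ^ ?d * (1 + - (2 * real r / N)) ^ ?d"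
    by (simp add: power_mult_distrib)
  have "real (card (lattice_box 0 (int N) - lattice_box (int r) (int N - int r) :: (int ^ 'd) set))
    = real (N ^ ?d) - real ((N - 2 * r) ^ ?d)"
    using card_mono[OF finite_lattice_box sub]
    by (simp only: card_Diff_subset[OF finite_lattice_box sub] of_nat_diff card_lattice_box nat_eq) simp
  also have "\<dots> = real N ^ ?d * (1 - (1 + - (2 * real r / N)) ^ ?d)"
    unfolding inner by (simp add: algebra_simps)
  also have "\<dots> \<le> real N ^ ?d * (1 - (1 + real ?d * - (2 * real r / N)))"
    using assms by (intro mult_left_mono diff_left_mono Bernoulli_inequality) (simp_all add: field_simps)
  finally show ?thesis
    by (simp add: card_lattice_box mult_ac)
qed


section \<open>Cells of a crystal framework\<close>

context crystal_framework
begin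

lemma edge_vertices:
  assumes "{v, w} \<in> E"
  shows "v \<in> V" "w \<in> V"
  using simple[OF assms] by (auto simp: doubleton_eq_iff)

lemma translate_edge_pair: "{v, w} \<in> E \<Longrightarrow> {T n v, T n w} \<in> E"
  using translate_edge[of "{v, w}" n] by simp

definition cell :: "'v \<Rightarrow> int ^ 'd" where
  "cell v = (THE n. v \<in> T n ` Fv)"

lemma cell_eqI:
  assumes "v \<in> T n ` Fv"
  shows "cell v = n"
  unfolding cell_def
proof (rule the_equality)
  show "v \<in> T n ` Fv"
    by (rule assms)
next
  fix m
  assume "v \<in> T m ` Fv"
  then show "m = n"
    using assms disjoint_vertex_translates by (auto simp: disjoint_family_on_def)
qed

lemma in_own_cell:
  assumes "v \<in> V"
  shows "v \<in> T (cell v) ` Fv"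
proof -
  obtain n where n: "v \<in> T n ` Fv"
    using assms Union_vertex_translates by blast
  show ?thesis
    unfolding cell_eqI[OF n] by (rule n)
qed

text \<open>Translates of the motif \<open>Fv\<close> are disjoint, so the lattice acts freely and cells are moved with it.\<close>

lemma cell_translate:
  assumes "v \<in> V"
  shows "cell (T n v) = n + cell v"
proof -
  obtain w where w: "w \<in> Fv" "v = T (cell v) w"
    using in_own_cell[OF assms] by blast
  then have "T n v = T (n + cell v) w"
    using Fv_subset by (metis subsetD translate_add)
  then show ?thesis
    using w(1) by (intro cell_eqI) blast
qed

lemma translates_distinct:
  assumes "v \<in> V" "T m v = T n v"
  shows "m = n"
proof -
  have "m + cell v = n + cell v"
    using assms(2) by (simp only: cell_translate[OF assms(1), symmetric])
  then show ?thesis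
    by simp
qed

lemma vertices_with_cell_in: "{v \<in> V. cell v \<in> D} = (\<Union>n\<in>D. T n ` Fv)"
proof -
  have "v \<in> T n ` Fv \<longleftrightarrow> v \<in> V \<and> cell v = n" for v n
  proof
    assume v: "v \<in> T n ` Fv"
    then have "v \<in> V"
      using Union_vertex_translates by blast
    with cell_eqI[OF v] show "v \<in> V \<and> cell v = n"
      by blast
  next
    assume "v \<in> V \<and> cell v = n"
    then show "v \<in> T n ` Fv"
      using in_own_cell[of v] by simp
  qed
  then show ?thesis
    by (simp only: set_eq_iff UN_iff mem_Collect_eq) blast
qed

lemma finite_vertices_with_cell_in: "finite D \<Longrightarrow> finite {v \<in> V. cell v \<in> D}"
  using finite_Fv by (simp add: vertices_with_cell_in)

lemma card_vertices_with_cell_in: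
  assumes "finite D"
  shows "card {v \<in> V. cell v \<in> D} \<le> card D * card Fv"
proof -
  have "card {v \<in> V. cell v \<in> D} \<le> (\<Sum>n\<in>D. card (T n ` Fv))"
    unfolding vertices_with_cell_in by (rule card_UN_le[OF assms])
  also have "\<dots> \<le> (\<Sum>n\<in>D. card Fv)"
    by (intro sum_mono card_image_le finite_Fv)
  finally show ?thesis
    by simp
qed

text \<open>
  Bonds have bounded reach: the difference of the cells of the two ends of an edge is invariant under
  translation, so it takes only the values that occur on the finite set \<open>Fe\<close>.
\<close>

lemma edge_range:
  obtains r :: nat where "\<And>v w i. {v, w} \<in> E \<Longrightarrow> \<bar>cell v $ i - cell w $ i\<bar> \<le> int r"
proof -
  let ?X = "(\<lambda>(v, w, i). nat \<bar>cell v $ i - cell w $ i\<bar>) ` (\<Union>Fe \<times> \<Union>Fe \<times> UNIV)"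
  have "finite e" if "e \<in> Fe" for e
    using that simple Fe_subset by fastforce
  then have "finite ?X"
    using finite_Fe by simp
  then obtain r where r: "\<forall>x\<in>?X. x \<le> r"
    using finite_nat_set_iff_bounded_le by auto
  have "\<bar>cell v $ i - cell w $ i\<bar> \<le> int r" if vw: "{v, w} \<in> E" for v w i
  proof -
    obtain n e where e: "e \<in> Fe" "{v, w} = T n ` e"
      using vw Union_edge_translates by blast
    then obtain x y where xy: "x \<in> e" "y \<in> e" "v = T n x" "w = T n y"
      by (metis imageE insertCI)
    have "x \<in> V" "y \<in> V"
      using e(1) xy(1,2) simple Fe_subset by fastforce+
    then have "cell v $ i - cell w $ i = cell x $ i - cell y $ i"
      using xy by (simp add: cell_translate)
    moreover have "nat \<bar>cell x $ i - cell y $ i\<bar> \<in> ?X"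
      using e(1) xy by (intro image_eqI[of _ _ "(x, y, i)"]) auto
    then have "nat \<bar>cell x $ i - cell y $ i\<bar> \<le> r"
      by (rule bspec[OF r])
    ultimately show ?thesis
      by simp
  qed
  then show thesis
    by (rule that)
qed

section \<open>Finitely supported flexes from square-summable ones\<close>

lemma flex_translate:
  fixes u :: "'v \<Rightarrow> real ^ 'd"
  assumes "infinitesimal_flex E p u"
  shows "infinitesimal_flex E p (\<lambda>v. u (T n v))"
  unfolding infinitesimal_flex_def
proof (intro allI impI)
  fix v w
  assume vw: "{v, w} \<in> E"
  have "p (T n v) - p (T n w) = p v - p w"
    using edge_vertices[OF vw] by (simp add: placement_translate)
  then show "(\<Sum>i\<in>UNIV. of_real ((p v - p w) $ i) * (u (T n v) - u (T n w)) $ i) = 0"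
    using assms translate_edge_pair[OF vw, of n] unfolding infinitesimal_flex_def by metis
qed

lemma flex_linear_combination:
  fixes u :: "'b \<Rightarrow> 'v \<Rightarrow> real ^ 'd"
  assumes "\<And>m. m \<in> B \<Longrightarrow> infinitesimal_flex E p (u m)"
  shows "infinitesimal_flex E p (\<lambda>v. \<Sum>m\<in>B. c m *\<^sub>R u m v)"
  unfolding infinitesimal_flex_def
proof (intro allI impI)
  fix v w
  assume vw: "{v, w} \<in> E"
  have "(\<Sum>i\<in>UNIV. of_real ((p v - p w) $ i) * ((\<Sum>m\<in>B. c m *\<^sub>R u m v) - (\<Sum>m\<in>B. c m *\<^sub>R u m w)) $ i)
    = (\<Sum>i\<in>UNIV. \<Sum>m\<in>B. c m * (of_real ((p v - p w) $ i) * (u m v - u m w) $ i))"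
    by (simp add: sum_subtractf[symmetric] sum_distrib_left algebra_simps)
  also have "\<dots> = (\<Sum>m\<in>B. c m * (\<Sum>i\<in>UNIV. of_real ((p v - p w) $ i) * (u m v - u m w) $ i))"
    by (subst sum.swap) (simp add: sum_distrib_left)
  also have "\<dots> = 0"
    using assms vw by (intro sum.neutral) (auto simp: infinitesimal_flex_def)
  finally show "(\<Sum>i\<in>UNIV. of_real ((p v - p w) $ i) *
      ((\<Sum>m\<in>B. c m *\<^sub>R u m v) - (\<Sum>m\<in>B. c m *\<^sub>R u m w)) $ i) = 0" .
qed

text \<open>
  Cutting \<open>f\<close> off outside \<open>S\<close> changes no velocity difference along an edge, except along
  those edges where both ends are at rest afterwards.
\<close>

lemma flex_truncate:
  fixes f :: "'v \<Rightarrow> real ^ 'd"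
  assumes "infinitesimal_flex E p f"
    and "\<And>v w. {v, w} \<in> E \<Longrightarrow> v \<in> S \<Longrightarrow> w \<notin> S \<Longrightarrow> f v = 0"
  shows "infinitesimal_flex E p (\<lambda>v. if v \<in> S then f v else 0)"
  unfolding infinitesimal_flex_def
proof (intro allI impI)
  fix v w
  assume vw: "{v, w} \<in> E"
  then have "{w, v} \<in> E"
    by (simp add: insert_commute)
  then have "((if v \<in> S then f v else 0) - (if w \<in> S then f w else 0)) \<in> {f v - f w, 0}"
    using assms(2)[of v w] assms(2)[of w v] vw by auto
  then consider "(if v \<in> S then f v else 0) - (if w \<in> S then f w else 0) = f v - f w"
    | "(if v \<in> S then f v else 0) - (if w \<in> S then f w else 0) = 0"
    by auto
  then show "(\<Sum>i\<in>UNIV. of_real ((p v - p w) $ i) *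
      ((if v \<in> S then f v else 0) - (if w \<in> S then f w else 0)) $ i) = 0"
    using assms(1) vw by cases (auto simp: infinitesimal_flex_def simp del: if_split)
qed

lemma square_summable_component_bound:
  fixes u :: "'v \<Rightarrow> real ^ 'd"
  assumes "square_summable_flex V u" "finite X" "X \<subseteq> V"
  shows "(\<Sum>v\<in>X. (u v $ i)\<^sup>2) \<le> (\<Sum>\<^sub>\<infinity>v\<in>V. (norm (u v))\<^sup>2)"
proof -
  have "(\<Sum>v\<in>X. (u v $ i)\<^sup>2) \<le> (\<Sum>v\<in>X. (norm (u v))\<^sup>2)"
    by (intro sum_mono) (metis component_le_norm_cart power2_abs power_mono abs_ge_zero)
  also have "\<dots> \<le> (\<Sum>\<^sub>\<infinity>v\<in>V. (norm (u v))\<^sup>2)"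
    using assms by (intro finite_sum_le_infsum) (auto simp: square_summable_flex_def)
  finally show ?thesis .
qed

text \<open>
  The contradiction between the trace bound and the smallness of the shell is arranged by choosing
  \<open>N\<close> with \<open>C / N < x^2\<close>, where \<open>x\<close> is a nonzero component of \<open>u\<close>: by \<open>card_lattice_box_shell\<close>,
  \<open>C / N\<close> times the number of cells bounds the number of conditions times the squared \<open>l^2\<close>-norm \<open>A\<close>.
\<close>

theorem square_summable_imp_internal:
  fixes u :: "'v \<Rightarrow> real ^ 'd"
  assumes flex: "infinitesimal_flex E p u" and "nonzero_flex V u"
    and l2: "square_summable_flex V u"
  shows "\<exists>g :: 'v \<Rightarrow> real ^ 'd. infinitesimal_flex E p g \<and> nonzero_flex V g \<and> internal_flex V g"
proof -
  obtain v0 i where v0: "v0 \<in> V" and ui: "u v0 $ i \<noteq> 0"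
    using assms(2) by (auto simp: nonzero_flex_def vec_eq_iff)
  obtain r :: nat where r: "\<And>v w i. {v, w} \<in> E \<Longrightarrow> \<bar>cell v $ i - cell w $ i\<bar> \<le> int r"
    using edge_range by blast
  define A where "A = (\<Sum>\<^sub>\<infinity>v\<in>V. (norm (u v))\<^sup>2)"
  define C where "C = 2 * real r * real CARD('d) * (real (card Fv) * real CARD('d)) * A"
  obtain N :: nat where N: "C / (u v0 $ i)\<^sup>2 + real (2 * r) < real N"
    using reals_Archimedean2 by blast
  have "A \<ge> 0"
    unfolding A_def by (intro infsum_nonneg) simp
  then have "C \<ge> 0"
    by (simp add: C_def)
  then have N2: "2 * r < N"
    using N by (smt (verit) divide_nonneg_nonneg of_nat_less_iff zero_le_power2)
  have "C / (u v0 $ i)\<^sup>2 < real N"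
    using N by (smt (verit) of_nat_0_le_iff)
  then have NC: "C / real N < (u v0 $ i)\<^sup>2"
    using ui N2 by (simp add: field_simps)
  define B :: "(int ^ 'd) set" where "B = lattice_box 0 (int N)"
  define D where "D = B - lattice_box (int r) (int N - int r)"
  have fin: "finite B" "finite D"
    by (simp_all add: B_def D_def finite_lattice_box)
  have "card B > 0"
    using N2 by (simp add: B_def card_lattice_box)
  have D: "card D \<le> 2 * real r * real CARD('d) / real N * card B"
    unfolding D_def B_def by (rule card_lattice_box_shell[OF N2])
  \<comment> \<open>Offset by \<open>cell v0\<close>, so that the orbit is sampled at \<open>w0\<close> in cell \<open>0\<close>, and \<open>T n w0\<close> lies in cell \<open>n\<close>.\<close>
  define w0 where "w0 = T (- cell v0) v0"
  define shift where "shift m v = u (T (cell v0 - m) v)" for m v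
  define M where "M n m = shift m (T n w0) $ i" for n m
  have M_eq: "M n m = u (T (n - m) v0) $ i" for n m
    using v0 by (simp add: M_def shift_def w0_def translate_vertex flip: translate_add)
  \<comment> \<open>One linear condition on the coefficients for each coordinate at each vertex of the shell.\<close>
  define H where "H = (\<lambda>(v, j) m. shift m v $ j) ` ({v \<in> V. cell v \<in> D} \<times> (UNIV :: 'd set))"
  have finD: "finite {v \<in> V. cell v \<in> D}"
    using fin by (simp add: finite_vertices_with_cell_in)
  then have "finite H"
    by (simp add: H_def)
  have "card H \<le> card {v \<in> V. cell v \<in> D} * CARD('d)"
    unfolding H_def using card_image_le[of "{v \<in> V. cell v \<in> D} \<times> (UNIV :: 'd set)"] finD
    by (simp add: card_cartesian_product)
  also have "\<dots> \<le> card D * card Fv * CARD('d)"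
    using card_vertices_with_cell_in[OF fin(2)] by simp
  finally have "card H \<le> card D * (card Fv * CARD('d))"
    by (simp add: mult.assoc)
  then have "real (card H) \<le> real (card D) * (real (card Fv) * real CARD('d))"
    by (metis of_nat_le_iff of_nat_mult)
  also have "\<dots> \<le> 2 * real r * real CARD('d) / real N * card B * (real (card Fv) * real CARD('d))"
    by (intro mult_right_mono D) simp
  finally have "real (card H) * A \<le> 2 * real r * real CARD('d) / real N * card B * (real (card Fv) * real CARD('d)) * A"
    using \<open>A \<ge> 0\<close> by (intro mult_right_mono)
  also have "\<dots> = C / real N * card B"
    by (simp add: C_def)
  also have "\<dots> < (u v0 $ i)\<^sup>2 * card B"
    using NC \<open>card B > 0\<close> by (intro mult_strict_right_mono) simp_all
  finally have few: "real (card H) * A < (u v0 $ i)\<^sup>2 * card B" .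
  have row: "(\<Sum>m\<in>B. (M n m)\<^sup>2) \<le> A" for n
  proof -
    have inj: "inj_on (\<lambda>m. T (n - m) v0) B"
      by (intro inj_onI) (auto dest: translates_distinct[OF v0])
    have "(\<Sum>m\<in>B. (M n m)\<^sup>2) = (\<Sum>v\<in>(\<lambda>m. T (n - m) v0) ` B. (u v $ i)\<^sup>2)"
      by (simp add: sum.reindex[OF inj] M_eq)
    also have "\<dots> \<le> A"
      unfolding A_def using fin v0 translate_vertex
      by (intro square_summable_component_bound[OF l2]) auto
    finally show ?thesis .
  qed
  have trace: "(\<Sum>n\<in>B. M n n) = card B * (u v0 $ i)"
    using v0 by (simp add: M_eq translate_zero)
  have "card H * (\<Sum>n\<in>B. \<Sum>m\<in>B. (M n m)\<^sup>2) \<le> card H * (card B * A)"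
    using row sum_bounded_above[of B "\<lambda>n. \<Sum>m\<in>B. (M n m)\<^sup>2" A] by (intro mult_left_mono) auto
  also have "\<dots> < card B * ((u v0 $ i)\<^sup>2 * card B)"
    using few \<open>card B > 0\<close> by (simp add: mult.left_commute)
  also have "\<dots> = (\<Sum>n\<in>B. M n n)\<^sup>2"
    by (simp add: trace power2_eq_square mult_ac)
  finally have "\<not> (\<Sum>n\<in>B. M n n)\<^sup>2 \<le> card H * (\<Sum>n\<in>B. \<Sum>m\<in>B. (M n m)\<^sup>2)"
    by simp
  then obtain c n where c: "\<forall>h\<in>H. dot_on B c h = 0" and n: "n \<in> B" "dot_on B c (M n) \<noteq> 0"
    using trace_square_le_constraints[OF fin(1) \<open>finite H\<close>, of M] by blast
  define f where "f v = (\<Sum>m\<in>B. c m *\<^sub>R shift m v)" for v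
  have f_component: "f v $ j = dot_on B c (\<lambda>m. shift m v $ j)" for v j
    by (simp add: f_def dot_on_def)
  have f_flex: "infinitesimal_flex E p f"
    unfolding f_def shift_def by (intro flex_linear_combination flex_translate flex)
  have f_shell: "f v = 0" if "v \<in> V" "cell v \<in> D" for v
  proof -
    have "(\<lambda>m. shift m v $ j) \<in> H" for j
      unfolding H_def using that by (intro image_eqI[of _ _ "(v, j)"]) auto
    then show ?thesis
      using c by (simp add: vec_eq_iff f_component)
  qed
  define S where "S = {v \<in> V. cell v \<in> B}"
  define g where "g v = (if v \<in> S then f v else 0)" for v
  have "infinitesimal_flex E p g"
    unfolding g_def
  proof (rule flex_truncate[OF f_flex])
    fix v w
    assume vw: "{v, w} \<in> E" "v \<in> S" "w \<notin> S"
    have "cell v \<notin> lattice_box (int r) (int N - int r)"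
    proof
      assume inner: "cell v \<in> lattice_box (int r) (int N - int r)"
      have "cell w $ j \<in> {0..<int N}" for j
      proof -
        have "cell v $ j \<in> {int r..<int N - int r}"
          using inner by (simp add: lattice_box_def)
        then show ?thesis
          using r[OF vw(1), of j] by auto
      qed
      then show False
        using vw(3) edge_vertices[OF vw(1)] by (simp add: S_def B_def lattice_box_def)
    qed
    then show "f v = 0"
      using vw(2) by (intro f_shell) (auto simp: S_def D_def)
  qed
  moreover have "nonzero_flex V g"
  proof -
    have w0: "w0 \<in> V" "cell w0 = 0"
      using v0 by (simp_all add: w0_def translate_vertex cell_translate)
    then have "T n w0 \<in> S"
      using n(1) by (simp add: S_def translate_vertex cell_translate)
    moreover have "f (T n w0) $ i \<noteq> 0"
      using n(2) by (simp add: f_component M_def[abs_def])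
    ultimately show ?thesis
      by (auto simp: nonzero_flex_def g_def S_def intro!: bexI[of _ "T n w0"])
  qed
  moreover have "internal_flex V g"
    unfolding internal_flex_def
    by (rule finite_subset[OF _ finite_vertices_with_cell_in[OF fin(1)]]) (auto simp: g_def S_def)
  ultimately show ?thesis
    by blast
qed

end

section \<open>Summability classes and complex scalars\<close>

lemma internal_imp_summable: "internal_flex V u \<Longrightarrow> summable_flex V u"
  unfolding internal_flex_def summable_flex_def
  by (rule finite_nonzero_values_imp_summable_on) simp

text \<open>A summable family is bounded by its sum \<open>A\<close>, so its squares are at most \<open>A\<close> times its terms.\<close>

lemma summable_imp_square_summable:
  assumes "summable_flex V u"
  shows "square_summable_flex V u"
proof -
  define A where "A = (\<Sum>\<^sub>\<infinity>v\<in>V. norm (u v))"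
  have summable: "(\<lambda>v. norm (u v)) summable_on V"
    using assms by (simp add: summable_flex_def)
  have "(norm (u v))\<^sup>2 \<le> A * norm (u v)" if "v \<in> V" for v
  proof -
    have "norm (u v) \<le> A"
      using finite_sum_le_infsum[OF summable, of "{v}"] that by (simp add: A_def)
    then show ?thesis
      by (simp add: power2_eq_square mult_right_mono)
  qed
  then show ?thesis
    unfolding square_summable_flex_def
    by (intro summable_on_comparison_test[OF summable_on_cmult_right[OF summable, of A]]) auto
qed

lemma flex_classes_equivalent:
  fixes V :: "'v set" and p :: "'v \<Rightarrow> real ^ 'd"
  assumes "\<And>u :: 'v \<Rightarrow> 'k :: real_normed_field ^ 'd.
    infinitesimal_flex E p u \<Longrightarrow> nonzero_flex V u \<Longrightarrow> square_summable_flex V u \<Longrightarrow>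
    \<exists>g :: 'v \<Rightarrow> 'k ^ 'd. infinitesimal_flex E p g \<and> nonzero_flex V g \<and> internal_flex V g"
  shows "((\<exists>u :: 'v \<Rightarrow> 'k ^ 'd. infinitesimal_flex E p u \<and> nonzero_flex V u \<and> internal_flex V u)
      \<longleftrightarrow> (\<exists>u :: 'v \<Rightarrow> 'k ^ 'd. infinitesimal_flex E p u \<and> nonzero_flex V u \<and> summable_flex V u)) \<and>
     ((\<exists>u :: 'v \<Rightarrow> 'k ^ 'd. infinitesimal_flex E p u \<and> nonzero_flex V u \<and> summable_flex V u)
      \<longleftrightarrow> (\<exists>u :: 'v \<Rightarrow> 'k ^ 'd. infinitesimal_flex E p u \<and> nonzero_flex V u \<and> square_summable_flex V u))"
  (is "(?I \<longleftrightarrow> ?S) \<and> (?S \<longleftrightarrow> ?Q)")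
proof -
  have "?I \<Longrightarrow> ?S"
    by (elim ex_forward conj_forward internal_imp_summable)
  moreover have "?S \<Longrightarrow> ?Q"
    by (elim ex_forward conj_forward summable_imp_square_summable)
  moreover have "?Q \<Longrightarrow> ?I"
    by (elim exE conjE) (rule assms)
  ultimately show ?thesis
    by argo
qed

definition complexify :: "('v \<Rightarrow> real ^ 'd) \<Rightarrow> 'v \<Rightarrow> complex ^ 'd" where
  "complexify u v = (\<chi> i. of_real (u v $ i))"

lemma complexify_flex:
  assumes "infinitesimal_flex E p u"
  shows "infinitesimal_flex E p (complexify u)"
  unfolding infinitesimal_flex_def
proof (intro allI impI)
  fix v w
  assume "{v, w} \<in> E"
  then have "complex_of_real (\<Sum>i\<in>UNIV. (p v - p w) $ i * (u v - u w) $ i) = 0"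
    using assms by (simp add: infinitesimal_flex_def)
  then show "(\<Sum>i\<in>UNIV. of_real ((p v - p w) $ i) * (complexify u v - complexify u w) $ i) = 0"
    by (simp add: complexify_def)
qed

lemma complexify_eq_0: "complexify u v = 0 \<longleftrightarrow> u v = 0"
  by (simp add: complexify_def vec_eq_iff)

lemma Re_Im_flex:
  fixes u :: "'v \<Rightarrow> complex ^ 'd"
  assumes "infinitesimal_flex E p u"
  shows "infinitesimal_flex E p (\<lambda>v. \<chi> i. Re (u v $ i))" "infinitesimal_flex E p (\<lambda>v. \<chi> i. Im (u v $ i))"
proof -
  have "(\<Sum>i\<in>UNIV. (p v - p w) $ i * (Re (u v $ i) - Re (u w $ i))) = 0
    \<and> (\<Sum>i\<in>UNIV. (p v - p w) $ i * (Im (u v $ i) - Im (u w $ i))) = 0"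
    if "{v, w} \<in> E" for v w
    using assms that unfolding infinitesimal_flex_def by (fastforce simp: complex_eq_iff)
  then show "infinitesimal_flex E p (\<lambda>v. \<chi> i. Re (u v $ i))" "infinitesimal_flex E p (\<lambda>v. \<chi> i. Im (u v $ i))"
    by (simp_all add: infinitesimal_flex_def)
qed

lemma square_summable_flex_mono:
  assumes "square_summable_flex V u" "\<And>v. norm (u' v) \<le> norm (u v)"
  shows "square_summable_flex V u'"
  using assms(1) unfolding square_summable_flex_def
  by (rule summable_on_comparison_test) (use assms(2) in \<open>auto intro: power_mono\<close>)

lemma real_part_square_summable:
  fixes u :: "'v \<Rightarrow> complex ^ 'd"
  assumes "infinitesimal_flex E p u" "nonzero_flex V u" "square_summable_flex V u"
  obtains u' :: "'v \<Rightarrow> real ^ 'd"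
  where "infinitesimal_flex E p u'" "nonzero_flex V u'" "square_summable_flex V u'"
proof -
  have sq: "square_summable_flex V (\<lambda>v. \<chi> i. Re (u v $ i))" "square_summable_flex V (\<lambda>v. \<chi> i. Im (u v $ i))"
    by (rule square_summable_flex_mono[OF assms(3)], rule norm_le_componentwise_cart,
        simp add: abs_Re_le_cmod abs_Im_le_cmod)+
  have "nonzero_flex V (\<lambda>v. \<chi> i. Re (u v $ i)) \<or> nonzero_flex V (\<lambda>v. \<chi> i. Im (u v $ i))"
    using assms(2) by (auto simp: nonzero_flex_def vec_eq_iff complex_eq_iff)
  then show thesis
    using that Re_Im_flex[OF assms(1)] sq by blast
qed

section \<open>Equivalence of the three kinds of flex\<close>

theorem corollary5p3:
  fixes V :: "'v set" and E :: "'v set set" and p :: "'v \<Rightarrow> real ^ 'd"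
    and a :: "'d \<Rightarrow> real ^ 'd" and T :: "int ^ 'd \<Rightarrow> 'v \<Rightarrow> 'v"
    and Fv :: "'v set" and Fe :: "'v set set"
  assumes "crystal_framework V E p a T Fv Fe"
    and "CARD('d) * card Fv = card Fe"
  shows
    "((\<exists>u :: 'v \<Rightarrow> complex ^ 'd. infinitesimal_flex E p u \<and> nonzero_flex V u \<and> internal_flex V u)
      \<longleftrightarrow> (\<exists>u :: 'v \<Rightarrow> complex ^ 'd. infinitesimal_flex E p u \<and> nonzero_flex V u \<and> summable_flex V u)) \<and>
     ((\<exists>u :: 'v \<Rightarrow> complex ^ 'd. infinitesimal_flex E p u \<and> nonzero_flex V u \<and> summable_flex V u)
      \<longleftrightarrow> (\<exists>u :: 'v \<Rightarrow> complex ^ 'd. infinitesimal_flex E p u \<and> nonzero_flex V u \<and> square_summable_flex V u))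
     \<and>
     ((\<exists>u :: 'v \<Rightarrow> real ^ 'd. infinitesimal_flex E p u \<and> nonzero_flex V u \<and> internal_flex V u)
      \<longleftrightarrow> (\<exists>u :: 'v \<Rightarrow> real ^ 'd. infinitesimal_flex E p u \<and> nonzero_flex V u \<and> summable_flex V u)) \<and>
     ((\<exists>u :: 'v \<Rightarrow> real ^ 'd. infinitesimal_flex E p u \<and> nonzero_flex V u \<and> summable_flex V u)
      \<longleftrightarrow> (\<exists>u :: 'v \<Rightarrow> real ^ 'd. infinitesimal_flex E p u \<and> nonzero_flex V u \<and> square_summable_flex V u))"
proof -
  interpret crystal_framework V E p a T Fv Fe
    by (rule assms(1))
  have real: "\<exists>g :: 'v \<Rightarrow> real ^ 'd. infinitesimal_flex E p g \<and> nonzero_flex V g \<and> internal_flex V g"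
    if "infinitesimal_flex E p u" "nonzero_flex V u" "square_summable_flex V u" for u :: "'v \<Rightarrow> real ^ 'd"
    by (rule square_summable_imp_internal[OF that])
  have complex: "\<exists>g :: 'v \<Rightarrow> complex ^ 'd. infinitesimal_flex E p g \<and> nonzero_flex V g \<and> internal_flex V g"
    if u: "infinitesimal_flex E p u" "nonzero_flex V u" "square_summable_flex V u" for u :: "'v \<Rightarrow> complex ^ 'd"
  proof -
    obtain u' :: "'v \<Rightarrow> real ^ 'd"
      where u': "infinitesimal_flex E p u'" "nonzero_flex V u'" "square_summable_flex V u'"
      using real_part_square_summable[OF u] by blast
    obtain g :: "'v \<Rightarrow> real ^ 'd"
      where g: "infinitesimal_flex E p g" "nonzero_flex V g" "internal_flex V g"
      using real[OF u'] by blast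
    have "nonzero_flex V (complexify g)" "internal_flex V (complexify g)"
      using g(2,3) by (simp_all add: nonzero_flex_def internal_flex_def complexify_eq_0)
    then show ?thesis
      using complexify_flex[OF g(1)] by blast
  qed
  show ?thesis
    using flex_classes_equivalent[OF complex] flex_classes_equivalent[OF real]
    by (simp only: simp_thms)
qed

end
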